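(* Let $\mathcal{R}$ be a unital ring with involution, let $m\in\mathcal{R}$ be invertible with $m^*=m$, and let $a,b\in\mathcal{R}^{\mathrm{core},m}$. If $a=a\,a^{\mathrm{core},m}b=b\,a^{\mathrm{core},m}a$, then $a-b\in\mathcal{R}^{\mathrm{core},m}$ and $$(a-b)^{\mathrm{core},m}=a\,a^{\mathrm{core},m}b^{\mathrm{core},m}-b^{\mathrm{core},m}.$$
   Context: $\mathcal{R}$ is a (not necessarily commutative) unital ring with an involution $x\mapsto x^*$ satisfying $(xy)^*=y^*x^*$, $(x+y)^*=x^*+y^*$, $(x^* )^*=x$. For an invertible $m\in\mathcal{R}$ with $m^*=m$, an element $z\in\mathcal{R}$ is the $m$-weighted core inverse of $a\in\mathcal{R}$ if $aza=a$, $z\mathcal{R}=a\mathcal{R}$ and $\mathcal{R}z=\mathcal{R}a^*m$. It is unique if it exists and is denoted $a^{\mathrm{core},m}$; $\mathcal{R}^{\mathrm{core},m}$ is the set of elements that have an $m$-weighted core inverse. *)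

theory Defs
  imports Main
begin

text \<open>The sort \<open>{ring, monoid_mult}\<close> is that of unital, not necessarily commutative rings. Unlike
  \<open>ring_1\<close> it does not impose \<open>0 \<noteq> 1\<close>, so the zero ring is included.\<close>

locale ring_involution =
  fixes star :: "'a::{ring, monoid_mult} \<Rightarrow> 'a"
  assumes star_mult: "star (x * y) = star y * star x"
    and star_add: "star (x + y) = star x + star y"
    and star_star: "star (star x) = x"

definition two_sided_invertible :: "'a::monoid_mult \<Rightarrow> bool" where
  "two_sided_invertible m \<longleftrightarrow> (\<exists>n. m * n = 1 \<and> n * m = 1)"

definition right_ideal_gen :: "'a::{ring, monoid_mult} \<Rightarrow> 'a set" where
  "right_ideal_gen a = {a * r | r. True}"

definition left_ideal_gen :: "'a::{ring, monoid_mult} \<Rightarrow> 'a set" where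
  "left_ideal_gen a = {r * a | r. True}"

definition is_core_inverse ::
    "('a::{ring, monoid_mult} \<Rightarrow> 'a) \<Rightarrow> 'a \<Rightarrow> 'a \<Rightarrow> 'a \<Rightarrow> bool" where
  "is_core_inverse star m a z \<longleftrightarrow>
     a * z * a = a \<and>
     right_ideal_gen z = right_ideal_gen a \<and>
     left_ideal_gen z = left_ideal_gen (star a * m)"

definition core_invertibles :: "('a::{ring, monoid_mult} \<Rightarrow> 'a) \<Rightarrow> 'a \<Rightarrow> 'a set" where
  "core_invertibles star m = {a. \<exists>z. is_core_inverse star m a z}"

text \<open>Only meaningful for \<open>a \<in> core_invertibles star m\<close>, with \<open>m\<close> invertible and self-adjoint; it is
  then characterised by \<open>core_inverse_eqI\<close> and \<open>core_inverse_is_core_inverse\<close> below.\<close>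

definition core_inverse :: "('a::{ring, monoid_mult} \<Rightarrow> 'a) \<Rightarrow> 'a \<Rightarrow> 'a \<Rightarrow> 'a" where
  "core_inverse star m a = (THE z. is_core_inverse star m a z)"

context ring_involution
begin

lemma core_inverse_equations:
  assumes m: "two_sided_invertible m" "star m = m"
    and z: "is_core_inverse star m a z"
  shows "a * z * a = a" "z * a * z = z" "a * z * z = z" "z * a * a = a"
    "star (m * a * z) = m * a * z"
proof -
  from m obtain n where n: "m * n = 1" "n * m = 1"
    unfolding two_sided_invertible_def by blast
  have star_one: "star 1 = 1"
    by (metis mult_1_left mult_1_right star_mult star_star)
  have star_n: "star n = n"
  proof -
    have "star n * m = 1" using star_mult[of m n] n m star_one by simp
    then show ?thesis by (metis mult.assoc mult_1_left mult_1_right n(1))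
  qed
  show aza: "a * z * a = a" using z by (simp add: is_core_inverse_def)
  have R: "right_ideal_gen z = right_ideal_gen a"
    and L: "left_ideal_gen z = left_ideal_gen (star a * m)"
    using z by (auto simp: is_core_inverse_def)
  have "z \<in> right_ideal_gen z" "a \<in> right_ideal_gen a" "z \<in> left_ideal_gen z"
    unfolding right_ideal_gen_def left_ideal_gen_def
    by (metis (mono_tags) mem_Collect_eq mult_1_left mult_1_right)+
  with R L obtain u t w where u: "z = a * u" and t: "a = z * t" and w: "z = w * (star a * m)"
    unfolding right_ideal_gen_def left_ideal_gen_def by blast
  show azz: "a * z * z = z" using aza u by (metis mult.assoc)
  have sa: "star a * star (a * z) = star a"
    using aza by (metis star_mult)
  have zz: "z * n * star (a * z) * m = z"
  proof -
    have "z * n = w * star a" using w n by (simp add: mult.assoc)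
    then show ?thesis using sa w by (metis mult.assoc)
  qed
  have h: "a * z * n * star (a * z) = a * z * n"
    using zz n by (metis mult.assoc mult_1_right)
  have "star (a * z * n * star (a * z)) = a * z * n * star (a * z)"
    by (simp add: star_mult star_star star_n mult.assoc)
  then have h2: "star (a * z * n) = a * z * n" using h by simp
  then have h3: "n * star (a * z) = a * z * n" using star_mult[of "a * z" n] star_n by simp
  show maz: "star (m * a * z) = m * a * z"
  proof -
    have "star (m * a * z) = star (a * z) * m" using star_mult[of m "a * z"] m by (simp add: mult.assoc)
    also have "\<dots> = m * (n * star (a * z)) * m" using n by (metis mult.assoc mult_1_left)
    also have "\<dots> = m * a * z" using h3 n by (simp add: mult.assoc)
    finally show ?thesis .
  qed
  show zaz: "z * a * z = z"
  proof -
    have "z * (n * star (a * z)) * m = z" using zz by (simp add: mult.assoc)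
    then show ?thesis using h3 n by (simp add: mult.assoc)
  qed
  show "z * a * a = a" using zaz t by (metis mult.assoc)
qed

lemma is_core_inverse_unique:
  assumes m: "two_sided_invertible m" "star m = m"
    and z: "is_core_inverse star m a z" and w: "is_core_inverse star m a w"
  shows "z = w"
proof -
  note Z = core_inverse_equations[OF m z] and W = core_inverse_equations[OF m w]
  from m obtain n where n: "m * n = 1" "n * m = 1"
    unfolding two_sided_invertible_def by blast
  have adj: "star (a * x) * m = m * (a * x)" if "star (m * a * x) = m * a * x" for x
    using that star_mult[of m "a * x"] m by (simp add: mult.assoc)
  have "m * (a * z) = star (a * z) * m" using adj[OF Z(5)] by simp
  also have "\<dots> = star (a * w * (a * z)) * m" using W(1) by (metis mult.assoc)
  also have "\<dots> = star (a * z) * (star (a * w) * m)" by (simp add: star_mult mult.assoc)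
  also have "\<dots> = star (a * z) * m * (a * w)" using adj[OF W(5)] by (simp add: mult.assoc)
  also have "\<dots> = m * (a * z) * (a * w)" using adj[OF Z(5)] by simp
  also have "\<dots> = m * (a * w)" using Z(1) by (metis mult.assoc)
  finally have "a * z = a * w" using n by (metis mult.assoc mult_1_left)
  then show ?thesis using Z W by (metis mult.assoc)
qed

lemma core_inverse_eqI:
  assumes "two_sided_invertible m" "star m = m" "is_core_inverse star m a z"
  shows "core_inverse star m a = z"
  unfolding core_inverse_def
  using assms is_core_inverse_unique by blast

lemma core_inverse_is_core_inverse:
  assumes "two_sided_invertible m" "star m = m" "a \<in> core_invertibles star m"
  shows "is_core_inverse star m a (core_inverse star m a)"
  using assms core_inverse_eqI unfolding core_invertibles_def by blast

end

end

theory Submission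
  imports Defs
begin

text \<open>Write \<open>x\<close> and \<open>y\<close> for the core inverses of \<open>a\<close> and \<open>b\<close>. Then \<open>p = a x\<close> and \<open>q = b y\<close> are
  idempotents that are self-adjoint for the form weighted by \<open>m\<close>, and the hypotheses say that
  \<open>a = p b\<close> and \<open>p = b x\<close>. The second equation gives \<open>q p = p\<close>, hence \<open>p q = p\<close> by taking
  adjoints. It also gives \<open>b a = a a\<close>, so \<open>b\<close> maps the range of \<open>p\<close> into itself.
  Relative to the decomposition \<open>1 = p + (1 - p)\<close>, the element \<open>b\<close> is therefore block upper
  triangular, \<open>a\<close> is its upper row, and \<open>b - a = (1 - p) b\<close> is its lower right corner. The
  core inverse \<open>y\<close> of \<open>b\<close> is block upper triangular as well, and its corner \<open>(1 - p) y\<close> is the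
  candidate for the core inverse of \<open>b - a\<close>; the corners multiply to \<open>(1 - p) b (1 - p) y = q - p\<close>, again a self-adjoint idempotent.

  To recognise the candidate \<open>z = p y - y\<close> as the core inverse of \<open>c = a - b\<close>, it suffices to verify
  \<open>c z z = z\<close>, \<open>z c c = c\<close> and the self-adjointness of \<open>m c z\<close>, by
  \<open>is_core_inverseI\<close>. The multiplication rules needed for this are in
  \<open>core_inverse_products\<close>.\<close>

context ring_involution
begin

lemma star_diff: "star (x - y) = star x - star y"
  using star_add[of "x - y" y] by (simp add: algebra_simps)

text \<open>The relations \<open>z = c z z\<close> and \<open>c = z c c\<close> make the right ideals equal and also yield the two
  von Neumann equations, since \<open>c z c = c z z c c = z c c\<close> and \<open>z c z = z c c z z = c z z\<close>. For the
  left ideals, self-adjointness exchanges \<open>m c z\<close> with \<open>z\<^sup>* c\<^sup>* m\<close>; the inverse of \<open>m\<close> then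
  extracts \<open>z\<close>.\<close>

lemma is_core_inverseI:
  assumes m: "two_sided_invertible m" "star m = m"
    and czz: "c * z * z = z" and zcc: "z * c * c = c"
    and sa: "star (m * c * z) = m * c * z"
  shows "is_core_inverse star m c z"
proof -
  from m obtain n where n: "n * m = 1"
    unfolding two_sided_invertible_def by blast
  have czc: "c * z * c = c" using czz zcc by (metis mult.assoc)
  have zcz: "z * c * z = z" using czz zcc by (metis mult.assoc)
  have sa': "star z * (star c * m) = m * c * z"
    using sa m by (simp add: star_mult mult.assoc)
  have z: "z = z * n * star z * (star c * m)"
  proof -
    have "z * n * star z * (star c * m) = z * n * (star z * (star c * m))"
      by (simp add: mult.assoc)
    also have "\<dots> = z * (n * m) * c * z"
      unfolding sa' by (simp add: mult.assoc)
    also have "\<dots> = z" using n zcz by simp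
    finally show ?thesis by simp
  qed
  have cm: "star c * m = star c * m * c * z"
  proof -
    have "star c * m = star c * (star z * (star c * m))"
      using arg_cong[OF czc, of star] by (simp add: star_mult flip: mult.assoc)
    also have "\<dots> = star c * m * c * z"
      unfolding sa' by (simp add: mult.assoc)
    finally show ?thesis .
  qed
  have "right_ideal_gen z = right_ideal_gen c"
    unfolding right_ideal_gen_def using czz zcc
    by (auto; metis mult.assoc)
  moreover have "left_ideal_gen z = left_ideal_gen (star c * m)"
    unfolding left_ideal_gen_def
  proof (intro equalityI subsetI; clarify)
    fix r
    show "\<exists>s. r * z = s * (star c * m) \<and> True" using z by (metis mult.assoc)
  next
    fix r
    show "\<exists>s. r * (star c * m) = s * z \<and> True" using cm by (metis mult.assoc)
  qed
  ultimately show ?thesis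
    using czc by (simp add: is_core_inverse_def)
qed

text \<open>If \<open>f\<close> and \<open>g\<close> are self-adjoint for the form weighted by \<open>m\<close>, then the adjoint of \<open>g f\<close>
  is \<open>f g\<close>.\<close>

lemma weighted_adjoint_absorb:
  assumes m: "two_sided_invertible m" "star m = m"
    and f: "star (m * f) = m * f" and g: "star (m * g) = m * g"
    and gf: "g * f = f"
  shows "f * g = f"
proof -
  from m obtain n where n: "n * m = 1"
    unfolding two_sided_invertible_def by blast
  have f': "star f * m = m * f" and g': "star g * m = m * g"
    using f g m by (simp_all add: star_mult)
  have "m * f = star (g * f) * m" using f' gf by simp
  also have "\<dots> = star f * m * g" using g' by (simp add: star_mult mult.assoc)
  also have "\<dots> = m * (f * g)" using f' by (simp add: mult.assoc)
  finally have "n * m * f = n * m * (f * g)" by (simp add: mult.assoc)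
  then show ?thesis using n by simp
qed

text \<open>Each equation is an entry of the block picture: \<open>b a = a a\<close> says that \<open>b\<close> and \<open>a\<close> agree
  on the range of \<open>a\<close>, and \<open>y a = x a\<close> says the same of their inverses. In particular the range
  of \<open>p\<close> is invariant under both \<open>b\<close> and \<open>y\<close>.\<close>

lemma core_inverse_products:
  assumes m: "two_sided_invertible m" "star m = m"
    and x: "is_core_inverse star m a x" and y: "is_core_inverse star m b y"
    and axb: "a * x * b = a" and bxa: "b * x * a = a"
  shows "b * x = a * x" "b * y * a = a" "a * y = a * x" "b * a = a * a" "y * a = x * a"
proof -
  note X = core_inverse_equations[OF m x] and Y = core_inverse_equations[OF m y]
  show bx: "b * x = a * x" using bxa X(2) by (metis mult.assoc)
  show qa: "b * y * a = a" using bxa Y(1) by (metis mult.assoc)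
  have "b * y * (a * x) = a * x" using qa by (metis mult.assoc)
  then have pq: "a * x * (b * y) = a * x"
    using weighted_adjoint_absorb[OF m, of "a * x" "b * y"] X(5) Y(5)
    by (simp add: mult.assoc)
  then show "a * y = a * x" using axb by (metis mult.assoc)
  show "b * a = a * a" using bxa X(4) by (metis mult.assoc)
  \<comment> \<open>As \<open>x = a x x = b x x\<close> lies in the range of \<open>b\<close>, the idempotent \<open>y b\<close> fixes it.\<close>
  have "y * b * x = x"
  proof -
    have "x = b * x * x" using X(3) bx by simp
    then show ?thesis using Y(4) by (metis mult.assoc)
  qed
  then show "y * a = x * a" using bxa by (metis mult.assoc)
qed

lemma is_core_inverse_diff:
  assumes m: "two_sided_invertible m" "star m = m"
    and x: "is_core_inverse star m a x" and y: "is_core_inverse star m b y"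
    and axb: "a * x * b = a" and bxa: "b * x * a = a"
  shows "is_core_inverse star m (a - b) (a * x * y - y)"
proof -
  note X = core_inverse_equations[OF m x] and Y = core_inverse_equations[OF m y]
  note P = core_inverse_products[OF m x y axb bxa]
  define c where "c = a - b"
  define z where "z = a * x * y - y"
  have cz: "c * z = b * y - a * x"
  proof -
    have "b * (a * x * y) = a * (a * x * y)" using P(4) by (metis mult.assoc)
    then show ?thesis unfolding c_def z_def using P(3) by (simp add: algebra_simps)
  qed
  have "c * z * z = z"
  proof -
    have "b * y * (a * x * y) = a * x * y" using P(2) by (metis mult.assoc)
    moreover have "a * x * (a * x * y) = a * x * y" using X(1) by (metis mult.assoc)
    moreover have "b * y * y = y" by (rule Y(3))
    ultimately show ?thesis unfolding cz unfolding z_def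
      by (simp add: right_diff_distrib left_diff_distrib)
  qed
  moreover have "z * c * c = c"
  proof -
    have pc: "a * x * c = 0" unfolding c_def using X(1) axb by (simp add: right_diff_distrib)
    \<comment> \<open>Only \<open>y c c\<close> modulo the range of \<open>p\<close> matters, and there it is \<open>- c\<close>.\<close>
    have "y * b * a = a" using P(4,5) X(4) by (metis mult.assoc)
    then have "y * c * c = x * a * c - (a - b)"
      unfolding c_def using P(5) Y(4) by (simp add: right_diff_distrib left_diff_distrib)
    then have ycc: "y * c * c = x * a * c - c" by (simp add: c_def)
    have "a * x * x * a * c = x * a * c" using X(3) by simp
    then have "a * x * (y * c * c) = x * a * c"
      unfolding ycc using pc by (simp add: right_diff_distrib flip: mult.assoc)
    moreover have "z * c * c = a * x * (y * c * c) - y * c * c"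
      unfolding z_def by (simp add: left_diff_distrib mult.assoc)
    ultimately show ?thesis using ycc by simp
  qed
  moreover have "star (m * c * z) = m * c * z"
    using X(5) Y(5) cz by (simp add: mult.assoc right_diff_distrib star_diff)
  ultimately show ?thesis
    using is_core_inverseI[OF m] unfolding c_def z_def by blast
qed

end

theorem theorem3p8:
  fixes star :: "'a::{ring, monoid_mult} \<Rightarrow> 'a" and m a b :: 'a
  assumes "ring_involution star"
    and "two_sided_invertible m" and "star m = m"
    and "a \<in> core_invertibles star m" and "b \<in> core_invertibles star m"
    and "a = a * core_inverse star m a * b"
    and "a = b * core_inverse star m a * a"
  shows "a - b \<in> core_invertibles star m \<and>
    core_inverse star m (a - b) =
      a * core_inverse star m a * core_inverse star m b - core_inverse star m b"
proof -
  interpret ring_involution star by fact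
  note m = assms(2,3)
  have "is_core_inverse star m (a - b)
      (a * core_inverse star m a * core_inverse star m b - core_inverse star m b)"
    using is_core_inverse_diff[OF m core_inverse_is_core_inverse[OF m assms(4)]
        core_inverse_is_core_inverse[OF m assms(5)]] assms(6,7) by simp
  then show ?thesis
    using core_inverse_eqI[OF m] unfolding core_invertibles_def by blast
qed

end
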